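(* Let $N\ge 1$, and let $(\overline{A},\overline{B})$ be an ordered pair of matrices in $\{0,1\}^{N\times N}$ that is compatible and such that the product $\overline{A}\,\overline{B}$ is a simple extension of $(\overline{A},\overline{B})$. Let $$F_{\overline{A},\overline{B}}:\operatorname{spr}(\overline{A})\times\operatorname{spr}(\overline{B})\to\operatorname{spr}(\overline{A}\,\overline{B}),\qquad F_{\overline{A},\overline{B}}(X,Y)=XY,$$ be the product map, and let $R=F_{\overline{A},\overline{B}}\big(\operatorname{spr}(\overline{A})\times\operatorname{spr}(\overline{B})\big)$ be its range. Then $R$ contains an open dense subset of $\operatorname{spr}(\overline{A}\,\overline{B})$, and $$\operatorname{meas}_{\operatorname{spr}(\overline{A}\,\overline{B})}\Big(\operatorname{cl}\big(\operatorname{spr}(\overline{A}\,\overline{B})\setminus R\big)\Big)=0;$$ that is, the system of algebraic equations $XY=C$ has a solution $X\in\operatorname{spr}(\overline{A})$, $Y\in\operatorname{spr}(\overline{B})$ for all $C\in\operatorname{spr}(\overline{A}\,\overline{B})$ outside a set whose closure has Lebesgue measure zero in $\operatorname{spr}(\overline{A}\,\overline{B})$.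
   Context: Let $V=\{1,\dots,N\}$. For a matrix $P\in\mathbb{C}^{N\times N}$, write $\mathcal{E}(P)=\{(n,l)\in V^2: P_{nl}\neq 0\}$ and $$\operatorname{spr}(P)=\{P'\in\mathbb{C}^{N\times N}: P_{nl}=0\text{ implies }P'_{nl}=0\},$$ a (closed) linear subspace of $\mathbb{C}^{N\times N}$. For a subspace $\mathcal{X}$ of $\mathbb{C}^{N\times N}$, $\operatorname{meas}_{\mathcal{X}}$ denotes Lebesgue measure on $\mathcal{X}$; $\operatorname{cl}$ denotes topological closure, and the topology is the usual Euclidean one. The product $\overline{A}\,\overline{B}$ is the ordinary matrix product (with nonnegative integer entries), so $\mathcal{E}(\overline{A}\,\overline{B})=\{(n,l)\in V^2:\sum_{m=1}^N\overline{A}_{nm}\overline{B}_{ml}\ne 0\}$. For $X\in\operatorname{spr}(\overline{A})$ and $Y\in\operatorname{spr}(\overline{B})$ one has $XY\in\operatorname{spr}(\overline{A}\,\overline{B})$. Compatible: an ordered pair $(\overline{A},\overline{B})$ of matrices in $\{0,1\}^{N\times N}$, both with all diagonal entries nonzero (equal to $1$), is compatible if $\mathcal{E}(\overline{B})\subseteq\mathcal{E}(\overline{A})$. Simple extension: for a compatible pair $(\overline{A},\overline{B})$ and $(m,l)\in\mathcal{E}(\overline{B})$, let $$\beta_{(m,l)}(\overline{B})=\{(n,l)\in\mathcal{E}(\overline{A}\,\overline{B})\setminus\mathcal{E}(\overline{A}) : \overline{A}_{nm}\overline{B}_{ml}\neq 0\}$$ (here $m,l$ are fixed and $n$ ranges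 over $V$). The product $\overline{A}\,\overline{B}$ is a simple extension of $(\overline{A},\overline{B})$ if $|\beta_{(m,l)}(\overline{B})|\le 1$ for all $(m,l)\in\mathcal{E}(\overline{B})$. *)

theory Defs
  imports "HOL-Analysis.Analysis"
begin

text \<open>Matrices over V = {1..N} are rendered over an arbitrary finite index type; the entry in
  row n and column l of P is P $ n $ l. Types are nonempty, so N \<ge> 1 is automatic.\<close>

definition nz_entries :: "complex ^ 'n ^ 'n \<Rightarrow> ('n \<times> 'n) set" where
  "nz_entries P = {(n, l). P $ n $ l \<noteq> 0}"

definition spr :: "complex ^ 'n ^ 'n \<Rightarrow> (complex ^ 'n ^ 'n) set" where
  "spr P = {P'. \<forall>n l. P $ n $ l = 0 \<longrightarrow> P' $ n $ l = 0}"

definition compatible :: "complex ^ 'n ^ 'n \<Rightarrow> complex ^ 'n ^ 'n \<Rightarrow> bool" where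
  "compatible A B \<longleftrightarrow>
     (\<forall>n l. A $ n $ l \<in> {0, 1}) \<and> (\<forall>n l. B $ n $ l \<in> {0, 1}) \<and>
     (\<forall>n. A $ n $ n \<noteq> 0) \<and> (\<forall>n. B $ n $ n \<noteq> 0) \<and>
     nz_entries B \<subseteq> nz_entries A"

definition new_entries ::
    "complex ^ 'n ^ 'n \<Rightarrow> complex ^ 'n ^ 'n \<Rightarrow> 'n \<Rightarrow> 'n \<Rightarrow> ('n \<times> 'n) set" where
  "new_entries A B m l =
     {(n, l') \<in> nz_entries (A ** B) - nz_entries A. l' = l \<and> A $ n $ m * B $ m $ l \<noteq> 0}"

definition simple_extension :: "complex ^ 'n ^ 'n \<Rightarrow> complex ^ 'n ^ 'n \<Rightarrow> bool" where
  "simple_extension A B \<longleftrightarrow> (\<forall>(m, l) \<in> nz_entries B. card (new_entries A B m l) \<le> 1)"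

definition prod_range :: "complex ^ 'n ^ 'n \<Rightarrow> complex ^ 'n ^ 'n \<Rightarrow> (complex ^ 'n ^ 'n) set" where
  "prod_range A B = (\<lambda>(X, Y). X ** Y) ` (spr A \<times> spr B)"

text \<open>Lebesgue measure on a linear subspace S of a Euclidean space is the completion of the image
  of the product of one-dimensional Lebesgue measures under coordinates with respect to an
  orthonormal basis of S. It does not depend on the basis, because linear isometries preserve
  Lebesgue measure. Complex matrices carry the real inner product that identifies them with real
  vectors of length 2 * N^2, so a complex subspace is measured through its real coordinates.\<close>

definition is_onb :: "'a::euclidean_space set \<Rightarrow> 'a set \<Rightarrow> bool" where
  "is_onb S B \<longleftrightarrow> B \<subseteq> S \<and> pairwise orthogonal B \<and> (\<forall>b\<in>B. norm b = 1) \<and> span B = S"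

definition onb :: "'a::euclidean_space set \<Rightarrow> 'a set" where
  "onb S = (SOME B. is_onb S B)"

definition subspace_lborel :: "'a::euclidean_space set \<Rightarrow> 'a measure" where
  "subspace_lborel S =
     distr (\<Pi>\<^sub>M b\<in>onb S. (lborel :: real measure)) (restrict_space borel S)
       (\<lambda>c. \<Sum>b\<in>onb S. c b *\<^sub>R b)"

definition subspace_lebesgue :: "'a::euclidean_space set \<Rightarrow> 'a measure" where
  "subspace_lebesgue S = completion (subspace_lborel S)"

lemma is_onb_onb:
  assumes "subspace S"
  shows "is_onb S (onb S)"
proof -
  have "\<exists>B. is_onb S B"
    using orthonormal_basis_subspace[OF assms] unfolding is_onb_def by metis
  then show ?thesis unfolding onb_def by (rule someI_ex)
qed

lemma measurable_onb_coords:
  assumes "subspace S"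
  shows "(\<lambda>c. \<Sum>b\<in>onb S. c b *\<^sub>R b)
    \<in> measurable (\<Pi>\<^sub>M b\<in>onb S. (lborel :: real measure)) (restrict_space borel S)"
proof (rule measurable_restrict_space2)
  have "b \<in> S" if "b \<in> onb S" for b
    using is_onb_onb[OF assms] that unfolding is_onb_def by auto
  then show "(\<lambda>c. \<Sum>b\<in>onb S. c b *\<^sub>R b) \<in> space (\<Pi>\<^sub>M b\<in>onb S. (lborel :: real measure)) \<rightarrow> S"
    by (auto intro!: subspace_sum subspace_scale assms)
  show "(\<lambda>c. \<Sum>b\<in>onb S. c b *\<^sub>R b)
    \<in> borel_measurable (\<Pi>\<^sub>M b\<in>onb S. (lborel :: real measure))"
    by (intro borel_measurable_sum borel_measurable_scaleR) measurable
qed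

lemma subspace_spr: "subspace (spr P)"
  by (auto simp: subspace_def spr_def)

lemma closed_spr:
  fixes P :: "complex ^ 'n ^ 'n"
  shows "closed (spr P)"
proof -
  have "spr P = (\<Inter>(n, l) \<in> {(n, l). P $ n $ l = 0}. {P'. P' $ n $ l = 0})"
    by (auto simp: spr_def)
  moreover have "closed {P' :: complex ^ 'n ^ 'n. P' $ n $ l = 0}" for n l :: 'n
    by (intro closed_Collect_eq continuous_intros)
  ultimately show ?thesis by auto
qed

lemma mult_in_spr:
  fixes A B X Y :: "complex ^ 'n ^ 'n"
  assumes "compatible A B" "X \<in> spr A" "Y \<in> spr B"
  shows "X ** Y \<in> spr (A ** B)"
proof -
  have "(X ** Y) $ n $ l = 0" if "(A ** B) $ n $ l = 0" for n l
  proof -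
    define f where "f m = (if A $ n $ m * B $ m $ l = 0 then 0 else 1 :: nat)" for m
    have f: "A $ n $ m * B $ m $ l = of_nat (f m)" for m
    proof -
      have "A $ n $ m = 0 \<or> A $ n $ m = 1" "B $ m $ l = 0 \<or> B $ m $ l = 1"
        using assms(1) unfolding compatible_def by blast+
      then show ?thesis unfolding f_def by auto
    qed
    have "of_nat (\<Sum>m\<in>UNIV. f m) = (0 :: complex)"
      using that by (simp add: matrix_matrix_mult_def f)
    then have "\<forall>m. f m = 0" unfolding of_nat_eq_0_iff by simp
    then have "\<forall>m. A $ n $ m = 0 \<or> B $ m $ l = 0"
      using f by (metis mult_eq_0_iff of_nat_0)
    then have "X $ n $ m * Y $ m $ l = 0" for m
      using assms(2,3) unfolding spr_def mem_Collect_eq by (metis mult_eq_0_iff)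
    then have "(\<Sum>m\<in>UNIV. X $ n $ m * Y $ m $ l) = 0" by (intro sum.neutral) blast
    then show ?thesis by (simp add: matrix_matrix_mult_def)
  qed
  then show ?thesis by (simp add: spr_def)
qed

end

theory Submission imports Defs begin

text \<open>Each new entry (n, l) of the product is obtained from an entry (m, l) of B, and by simplicity
  of the extension an entry of B serves at most one new entry. Freeing exactly these entries of Y
  around the identity, X Y = C becomes a square polynomial system whose Jacobian at X = A, Y = 1 is
  triangular with nonzero diagonal. A square polynomial map with a nonsingular Jacobian somewhere
  attains every value outside the zero set of some nonzero polynomial g, and such a zero set is
  closed, nowhere dense and of measure zero.\<close>

section \<open>Polynomial functions\<close>

text \<open>At X = A, Y = 1 the product map linearizes to dX + A dY. Entries on the support of A are
  already reached by dX, so dY is only needed at new entries; there simplicity prevents the free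
  entries of one column of Y from being coupled into a possibly singular block. A nonsingular
  Jacobian at one point yields only an open set of values, and over the reals no more can be
  expected: squaring is regular at 1 and misses every negative number. Over the complex numbers the
  complement of a hypersurface is connected, so it suffices that the range is open and closed
  relative to such a complement. Both properties come from one source: any polynomial p satisfies a
  nontrivial polynomial relation with the components of F. Its lowest coefficient controls where p
  can vanish on a fibre, its highest coefficient how large p can become there.\<close>

inductive cpoly :: "(complex ^ 'k \<Rightarrow> complex) \<Rightarrow> bool" where
  const: "cpoly (\<lambda>_. c)"
| coord: "cpoly (\<lambda>x. x $ i)"
| add: "cpoly f \<Longrightarrow> cpoly g \<Longrightarrow> cpoly (\<lambda>x. f x + g x)"
| mult: "cpoly f \<Longrightarrow> cpoly g \<Longrightarrow> cpoly (\<lambda>x. f x * g x)"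

lemma cpoly_sum: "(\<And>i. i \<in> I \<Longrightarrow> cpoly (f i)) \<Longrightarrow> cpoly (\<lambda>x. \<Sum>i\<in>I. f i x)"
  by (induction I rule: infinite_finite_induct) (auto intro: cpoly.intros)

lemma cpoly_prod: "(\<And>i. i \<in> I \<Longrightarrow> cpoly (f i)) \<Longrightarrow> cpoly (\<lambda>x. \<Prod>i\<in>I. f i x)"
  by (induction I rule: infinite_finite_induct) (auto intro: cpoly.intros)

lemma cpoly_power: "cpoly f \<Longrightarrow> cpoly (\<lambda>x. f x ^ n)"
  by (induction n) (auto intro: cpoly.intros)

lemma cpoly_det:
  assumes "\<And>i j. cpoly (\<lambda>x. M x $ i $ j)"
  shows "cpoly (\<lambda>x. det (M x))"
  unfolding det_def
  by (intro cpoly_sum cpoly.mult cpoly.const cpoly_prod assms)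

lemma cpoly_continuous: "cpoly f \<Longrightarrow> continuous_on S f"
  by (induction rule: cpoly.induct) (auto intro!: continuous_intros)

text \<open>Restriction to a complex line replaces several variables by one, where a nonzero
  polynomial has finitely many roots; density, absence of zero divisors and connectedness below all
  rest on this.\<close>

lemma cpoly_line:
  assumes "cpoly f"
  shows "\<exists>q. \<forall>t. f (x + t *s d) = poly q t"
  using assms
proof induction
  case (const c)
  show ?case by (rule exI[of _ "[:c:]"]) simp
next
  case (coord i)
  show ?case by (rule exI[of _ "[:x $ i, d $ i:]"]) simp
next
  case (add f g)
  then show ?case by (metis poly_add)
next
  case (mult f g)
  then show ?case by (metis poly_mult)
qed

text \<open>The partial derivatives must again be polynomials, so that the Jacobian determinant is
  one and algebraic dependence applies to it.\<close>

lemma cpoly_has_derivative: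
  fixes f :: "complex ^ 'k \<Rightarrow> complex"
  assumes "cpoly f"
  shows "\<exists>f'. (\<forall>j. cpoly (f' j)) \<and> (\<forall>x. (f has_derivative (\<lambda>v. \<Sum>j\<in>UNIV. f' j x * v $ j)) (at x))"
  using assms
proof induction
  case (const c)
  show ?case by (rule exI[of _ "\<lambda>_ _. 0"]) (auto intro: cpoly.const)
next
  case (coord i)
  show ?case
  proof (rule exI[of _ "\<lambda>j _. if j = i then 1 else 0"], intro conjI allI)
    show "((\<lambda>x. x $ i) has_derivative (\<lambda>v. \<Sum>j\<in>UNIV. (if j = i then 1 else 0) * v $ j)) (at x)" 
      for x :: "complex ^ 'k"
      by (simp add: if_distrib[of "\<lambda>a. a * _"] sum.delta cong: if_cong)
        (rule bounded_linear_imp_has_derivative[OF bounded_linear_vec_nth])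
  qed (rule cpoly.const)
next
  case (add f g)
  then obtain f' g' where d: "\<forall>j. cpoly (f' j)" "\<forall>j. cpoly (g' j)"
    "\<And>x. (f has_derivative (\<lambda>v. \<Sum>j\<in>UNIV. f' j x * v $ j)) (at x)"
    "\<And>x. (g has_derivative (\<lambda>v. \<Sum>j\<in>UNIV. g' j x * v $ j)) (at x)" by blast
  show ?case
  proof (rule exI[of _ "\<lambda>j x. f' j x + g' j x"], intro conjI allI)
    show "((\<lambda>x. f x + g x) has_derivative (\<lambda>v. \<Sum>j\<in>UNIV. (f' j x + g' j x) * v $ j)) (at x)" for x
      using has_derivative_add[OF d(3) d(4)] by (simp add: distrib_right sum.distrib)
  qed (use d in \<open>auto intro: cpoly.intros\<close>)
next
  case (mult f g)
  then obtain f' g' where d: "\<forall>j. cpoly (f' j)" "\<forall>j. cpoly (g' j)"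
    "\<And>x. (f has_derivative (\<lambda>v. \<Sum>j\<in>UNIV. f' j x * v $ j)) (at x)"
    "\<And>x. (g has_derivative (\<lambda>v. \<Sum>j\<in>UNIV. g' j x * v $ j)) (at x)" by blast
  show ?case
  proof (rule exI[of _ "\<lambda>j x. f x * g' j x + f' j x * g x"], intro conjI allI)
    show "((\<lambda>x. f x * g x) has_derivative
        (\<lambda>v. \<Sum>j\<in>UNIV. (f x * g' j x + f' j x * g x) * v $ j)) (at x)" for x
      using has_derivative_mult[OF d(3) d(4)]
      by (simp add: distrib_right sum.distrib sum_distrib_left sum_distrib_right algebra_simps)
      show "cpoly (\<lambda>x. f x * g' j x + f' j x * g x)" for j
      using d(1,2) mult.hyps by (intro cpoly.add cpoly.mult) auto
  qed
qed

lemma cpoly_real_line: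
  assumes "cpoly f"
  shows "\<exists>q. \<forall>t::real. f (x + t *\<^sub>R d) = poly q (of_real t)"
proof -
  obtain q where "\<And>t. f (x + t *s d) = poly q t" using cpoly_line[OF assms] by metis
  moreover have "t *\<^sub>R d = of_real t *s d" for t
    by (simp add: vec_eq_iff scaleR_conv_of_real[where 'a=complex])
  ultimately show ?thesis by metis
qed

text \<open>\<open>poly q\<close> is nonzero at 1, hence has finitely many roots, and arbitrarily
  small \<open>t\<close> avoid them. The space is general because both vectors and matrices occur
  later.\<close>

lemma nonzero_near_on_line:
  fixes f :: "'a::real_normed_vector \<Rightarrow> complex"
  assumes "\<And>t::real. f (x + t *\<^sub>R (y - x)) = poly q (of_real t)" "f y \<noteq> 0" "e > 0"
  shows "\<exists>t. dist (x + t *\<^sub>R (y - x)) x < e \<and> f (x + t *\<^sub>R (y - x)) \<noteq> 0"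
proof -
  have "poly q 1 \<noteq> 0" using assms(1)[of 1] assms(2) by simp
  then have "finite {t. poly q t = 0}" by (intro poly_roots_finite) auto
  then have "finite (of_real -` {t. poly q t = 0} :: real set)"
    by (intro finite_vimageI) (auto simp: inj_on_def)
  \<comment> \<open>The added 1 keeps the denominator positive when \<open>y = x\<close>.\<close>
  moreover have "infinite {0<..<e / (norm (y - x) + 1)}"
    using assms(3) by (intro infinite_Ioo) (simp add: add_nonneg_pos)
  ultimately have "\<not> {0<..<e / (norm (y - x) + 1)} \<subseteq> of_real -` {t. poly q t = 0}"
    using finite_subset by blast
  then obtain t :: real where "t \<in> {0<..<e / (norm (y - x) + 1)} - of_real -` {t. poly q t = 0}"
    by blast
  then have t: "0 < t" "t < e / (norm (y - x) + 1)" "poly q (of_real t) \<noteq> 0" by auto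
  have "t * norm (y - x) \<le> t * (norm (y - x) + 1)" using t by simp
  also have "\<dots> < e" using t by (simp add: pos_less_divide_eq add_nonneg_pos)
  finally have "dist (x + t *\<^sub>R (y - x)) x < e" unfolding dist_norm using t by simp
  then show ?thesis using t(3) assms(1) by metis
qed

lemma cpoly_nonzero_near:
  assumes "cpoly f" "f y \<noteq> 0" "e > 0"
  shows "\<exists>x'. dist x' x < e \<and> f x' \<noteq> 0"
  using cpoly_real_line[OF assms(1), of x "y - x"] nonzero_near_on_line[of f x y _ e] assms(2,3)
  by blast

text \<open>Absence of zero divisors is inherited from univariate polynomials: on the line from
  \<open>x\<close> (parameter 0) to \<open>y\<close> (parameter 1) the restriction of
  \<open>f\<close> is nonzero.\<close>

lemma cpoly_mult_zero:
  assumes "cpoly f" "cpoly g" "\<And>x. f x * g x = 0" "f y \<noteq> 0"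
  shows "g x = 0"
proof -
  obtain q where q: "\<And>t. f (x + t *s (y - x)) = poly q t"
    using cpoly_line[OF assms(1)] by metis
  obtain r where r: "\<And>t. g (x + t *s (y - x)) = poly r t"
    using cpoly_line[OF assms(2)] by metis
  have "poly (q * r) t = 0" for t using assms(3) q r by (metis poly_mult)
  then have "q * r = 0" using poly_all_0_iff_0 by blast
  moreover have "q \<noteq> 0" using q[of 1] assms(4) by auto
  ultimately have "r = 0" by simp
  then show ?thesis using r[of 0] by simp
qed

lemma cpoly_prod_nonzero:
  assumes "finite I" "\<And>i. i \<in> I \<Longrightarrow> cpoly (f i)" "\<And>i. i \<in> I \<Longrightarrow> \<exists>y. f i y \<noteq> 0"
  shows "\<exists>y. (\<Prod>i\<in>I. f i y) \<noteq> 0"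
  using assms
proof (induction I rule: finite_induct)
  case (insert i I)
  have "\<exists>z. (\<Prod>i\<in>I. f i z) \<noteq> 0" by (rule insert.IH) (use insert.prems in auto)
  moreover have "\<exists>y. f i y \<noteq> 0" using insert.prems by auto
  ultimately obtain y z where "f i y \<noteq> 0" "(\<Prod>i\<in>I. f i z) \<noteq> 0" by auto
  then have "\<exists>x. f i x * (\<Prod>i\<in>I. f i x) \<noteq> 0"
    using cpoly_mult_zero[of "f i" "\<lambda>x. \<Prod>i\<in>I. f i x" y z] cpoly_prod[of I f] insert.prems(1) by auto
  then show ?case using insert by simp
qed auto

section \<open>Algebraic dependence\<close>

text \<open>Elimination: equation \<open>j0\<close> is solved for an unknown \<open>i0\<close> with
  nonzero coefficient, and substitution leaves one equation and one unknown fewer. Without such a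
  coefficient the equation is void.\<close>

lemma homogeneous_system_nontrivial:
  fixes a :: "'i \<Rightarrow> 'j \<Rightarrow> 'a::field"
  assumes "finite J" "finite I" "card J < card I"
  shows "\<exists>c. (\<exists>i\<in>I. c i \<noteq> 0) \<and> (\<forall>j\<in>J. (\<Sum>i\<in>I. c i * a i j) = 0)"
  using assms
proof (induction J arbitrary: I a rule: finite_induct)
  case empty
  then obtain i where "i \<in> I" by fastforce
  then show ?case by (intro exI[of _ "\<lambda>_. 1"]) auto
next
  case (insert j0 J)
  show ?case
  proof (cases "\<forall>i\<in>I. a i j0 = 0")
    case True
    from insert.IH[of I a] insert.prems insert.hyps obtain c where
      "\<exists>i\<in>I. c i \<noteq> 0" "\<forall>j\<in>J. (\<Sum>i\<in>I. c i * a i j) = 0" by auto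
    with True show ?thesis by (intro exI[of _ c]) auto
  next
    case False
    then obtain i0 where i0: "i0 \<in> I" "a i0 j0 \<noteq> 0" by auto
    let ?I = "I - {i0}"
    have "card J < card ?I" using insert.prems insert.hyps i0 by simp
    from insert.IH[OF _ this, of "\<lambda>i j. a i j - a i j0 / a i0 j0 * a i0 j"] insert.prems
    obtain c where c: "\<exists>i\<in>?I. c i \<noteq> 0"
      "\<forall>j\<in>J. (\<Sum>i\<in>?I. c i * (a i j - a i j0 / a i0 j0 * a i0 j)) = 0" by auto
    define s where "s = (\<Sum>i\<in>?I. c i * a i j0)"
    define c' where "c' = c(i0 := - s / a i0 j0)"
    have split: "(\<Sum>i\<in>I. c' i * a i j) = - s / a i0 j0 * a i0 j + (\<Sum>i\<in>?I. c i * a i j)" for j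
    proof -
      have "(\<Sum>i\<in>?I. c' i * a i j) = (\<Sum>i\<in>?I. c i * a i j)"
        by (intro sum.cong) (auto simp: c'_def)
      then show ?thesis using sum.remove[OF insert.prems(1) i0(1), of "\<lambda>i. c' i * a i j"]
        by (simp add: c'_def)
    qed
    have "(\<Sum>i\<in>?I. c i * (a i j - a i j0 / a i0 j0 * a i0 j)) =
        (\<Sum>i\<in>?I. c i * a i j) - s / a i0 j0 * a i0 j" for j
      by (simp add: s_def right_diff_distrib sum_subtractf sum_divide_distrib sum_distrib_right mult.assoc)
    then have "\<forall>j\<in>J. (\<Sum>i\<in>I. c' i * a i j) = 0" using c(2) split by simp
    moreover have "(\<Sum>i\<in>I. c' i * a i j0) = 0" using i0 by (simp add: split s_def)
    moreover have "\<exists>i\<in>I. c' i \<noteq> 0" using c(1) by (auto simp: c'_def)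
    ultimately show ?thesis by auto
  qed
qed

text \<open>Freezing all variables but \<open>k\<close> leaves a univariate polynomial that vanishes
  everywhere, so each of its coefficients, a polynomial in the remaining variables, vanishes
  everywhere as well.\<close>

lemma monomials_independent:
  fixes c :: "('k \<Rightarrow> nat) \<Rightarrow> 'a::{idom,ring_char_0}"
  assumes "finite I"
    and "\<And>x. (\<Sum>\<beta>\<in>I \<rightarrow>\<^sub>E {..D}. c \<beta> * (\<Prod>i\<in>I. x i ^ \<beta> i)) = 0"
    and "\<beta> \<in> I \<rightarrow>\<^sub>E {..D}"
  shows "c \<beta> = 0"
  using assms
proof (induction I arbitrary: c \<beta> rule: finite_induct)
  case empty
  then show ?case by simp
next
  case (insert k I)
  let ?B = "I \<rightarrow>\<^sub>E {..D}"
  have key: "(\<Sum>\<gamma>\<in>?B. c (\<gamma>(k := a)) * (\<Prod>i\<in>I. x i ^ \<gamma> i)) = 0" if a: "a \<le> D" for a x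
  proof -
    define q where "q = (\<Sum>a\<le>D. monom (\<Sum>\<gamma>\<in>?B. c (\<gamma>(k := a)) * (\<Prod>i\<in>I. x i ^ \<gamma> i)) a)"
    have "poly q t = 0" for t
    proof -
      have "(\<Sum>\<beta>\<in>insert k I \<rightarrow>\<^sub>E {..D}. c \<beta> * (\<Prod>i\<in>insert k I. (x(k := t)) i ^ \<beta> i)) =
        (\<Sum>(a,\<gamma>)\<in>{..D} \<times> ?B. c (\<gamma>(k := a)) * (\<Prod>i\<in>insert k I. (x(k := t)) i ^ (\<gamma>(k:=a)) i))"
        unfolding PiE_insert_eq
        by (subst sum.reindex[OF inj_combinator[OF insert.hyps(2)]]) (simp add: case_prod_unfold)
      also have "\<dots> = (\<Sum>(a,\<gamma>)\<in>{..D} \<times> ?B. c (\<gamma>(k := a)) * (\<Prod>i\<in>I. x i ^ \<gamma> i) * t ^ a)"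
      proof (intro sum.cong refl, clarify)
        fix a \<gamma>
        have "(\<Prod>i\<in>I. (x(k := t)) i ^ (\<gamma>(k := a)) i) = (\<Prod>i\<in>I. x i ^ \<gamma> i)"
          using insert.hyps by (intro prod.cong) auto
        then show "c (\<gamma>(k := a)) * (\<Prod>i\<in>insert k I. (x(k := t)) i ^ (\<gamma>(k := a)) i)
          = c (\<gamma>(k := a)) * (\<Prod>i\<in>I. x i ^ \<gamma> i) * t ^ a"
          using insert.hyps by (simp add: mult_ac)
      qed
      also have "\<dots> = poly q t"
        by (simp add: q_def poly_sum poly_monom sum.cartesian_product[symmetric] sum_distrib_right)
      finally show ?thesis using insert.prems(1) by metis
    qed
    then have "q = 0" using poly_all_0_iff_0 by blast
    then have "coeff q a = 0" by simp
    then show ?thesis using a by (simp add: q_def coeff_sum)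
  qed
  have "\<beta> = (restrict \<beta> I)(k := \<beta> k)" using insert.prems(2) 
    by (auto simp: fun_eq_iff PiE_iff extensional_def restrict_def)
  moreover have B: "restrict \<beta> I \<in> ?B" "\<beta> k \<le> D" using insert.prems(2) by auto
  have "c ((restrict \<beta> I)(k := \<beta> k)) = 0"
    by (rule insert.IH[where c = "\<lambda>\<gamma>. c (\<gamma>(k := \<beta> k))", OF key[OF B(2)] B(1)])
  ultimately show ?case by simp
qed

text \<open>The degree is bounded in each variable separately, not in total: the exponent vectors
  then form a box with exactly \<open>(d + 1) ^ CARD('k)\<close> elements, which keeps the dimension
  count elementary.\<close>

definition box_poly :: "nat \<Rightarrow> (complex ^ 'k \<Rightarrow> complex) \<Rightarrow> bool" where
  "box_poly d f \<longleftrightarrow> (\<exists>a. \<forall>x. f x = (\<Sum>\<beta>\<in>UNIV \<rightarrow>\<^sub>E {..d}. a \<beta> * (\<Prod>i\<in>UNIV. x $ i ^ \<beta> i)))"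

lemma finite_box: "finite ((UNIV::'k::finite set) \<rightarrow>\<^sub>E {..d::nat})"
  by (intro finite_PiE) auto

lemma box_poly_monomial:
  assumes "\<And>i. \<beta> i \<le> d"
  shows "box_poly d (\<lambda>x. c * (\<Prod>i\<in>UNIV. x $ i ^ \<beta> i))"
  unfolding box_poly_def
proof (intro exI[of _ "\<lambda>\<gamma>. if \<gamma> = \<beta> then c else 0"] allI)
  fix x :: "complex ^ 'a"
  have "\<beta> \<in> UNIV \<rightarrow>\<^sub>E {..d}" using assms by auto
  then show "c * (\<Prod>i\<in>UNIV. x $ i ^ \<beta> i) =
    (\<Sum>\<gamma>\<in>UNIV \<rightarrow>\<^sub>E {..d}. (if \<gamma> = \<beta> then c else 0) * (\<Prod>i\<in>UNIV. x $ i ^ \<gamma> i))"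
    by (simp add: if_distrib[of "\<lambda>a. a * _"] sum.delta finite_box cong: if_cong)
qed

lemma box_poly_add:
  assumes "box_poly d f" "box_poly d g"
  shows "box_poly d (\<lambda>x. f x + g x)"
proof -
  obtain a b where ab: "\<And>x. f x = (\<Sum>\<beta>\<in>UNIV \<rightarrow>\<^sub>E {..d}. a \<beta> * (\<Prod>i\<in>UNIV. x $ i ^ \<beta> i))"
    "\<And>x. g x = (\<Sum>\<beta>\<in>UNIV \<rightarrow>\<^sub>E {..d}. b \<beta> * (\<Prod>i\<in>UNIV. x $ i ^ \<beta> i))"
    using assms unfolding box_poly_def by blast
  then show ?thesis unfolding box_poly_def
    by (intro exI[of _ "\<lambda>\<beta>. a \<beta> + b \<beta>"]) (simp add: distrib_right sum.distrib)
qed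

lemma box_poly_sum:
  assumes "\<And>i. i \<in> I \<Longrightarrow> box_poly d (f i)"
  shows "box_poly d (\<lambda>x. \<Sum>i\<in>I. f i x)"
  using assms
proof (induction I rule: infinite_finite_induct)
  case (insert i I)
  then show ?case by (auto intro: box_poly_add)
qed (use box_poly_monomial[of "\<lambda>_. 0" d 0] in simp_all)

lemma box_poly_mult:
  assumes "box_poly d f" "box_poly e g"
  shows "box_poly (d + e) (\<lambda>x. f x * g x)"
proof -
  obtain a b where ab: "\<And>x. f x = (\<Sum>\<beta>\<in>UNIV \<rightarrow>\<^sub>E {..d}. a \<beta> * (\<Prod>i\<in>UNIV. x $ i ^ \<beta> i))"
    "\<And>x. g x = (\<Sum>\<beta>\<in>UNIV \<rightarrow>\<^sub>E {..e}. b \<beta> * (\<Prod>i\<in>UNIV. x $ i ^ \<beta> i))"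
    using assms unfolding box_poly_def by blast
  have "(\<lambda>x. f x * g x) = (\<lambda>x. \<Sum>\<beta>\<in>UNIV \<rightarrow>\<^sub>E {..d}. \<Sum>\<gamma>\<in>UNIV \<rightarrow>\<^sub>E {..e}.
      (a \<beta> * b \<gamma>) * (\<Prod>i\<in>UNIV. x $ i ^ (\<beta> i + \<gamma> i)))"
    unfolding ab sum_product by (simp add: power_add prod.distrib mult_ac)
  moreover have "box_poly (d + e) \<dots>"
    by (intro box_poly_sum box_poly_monomial add_mono) auto
  ultimately show ?thesis by simp
qed

text \<open>Multiplying by the constant 1, regarded as having degree up to \<open>e - d\<close>,
  raises the bound without reindexing coefficients.\<close>

lemma box_poly_mono:
  assumes "box_poly d f" "d \<le> e"
  shows "box_poly e f"
proof -
  have "box_poly (e - d) (\<lambda>x :: complex ^ 'a. 1 * (\<Prod>i\<in>UNIV. x $ i ^ 0))"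
    by (rule box_poly_monomial[where \<beta> = "\<lambda>_. 0"]) auto
  from box_poly_mult[OF assms(1) this] show ?thesis using assms(2) by simp
qed

lemma box_poly_const: "box_poly d (\<lambda>_. c)"
  using box_poly_monomial[of "\<lambda>_. 0" d c] by simp

lemma cpoly_imp_box_poly:
  assumes "cpoly f"
  shows "\<exists>d. box_poly d f"
  using assms
proof induction
  case (const c)
  show ?case using box_poly_const by blast
next
  case (coord i)
  have "(\<Prod>j\<in>UNIV. x $ j ^ (if j = i then 1 else 0)) = x $ i" for x :: "complex ^ 'a"
    by (simp add: if_distrib[of "\<lambda>a. _ ^ a"] prod.delta cong: if_cong)
  moreover have "box_poly 1 (\<lambda>x :: complex ^ 'a. 1 * (\<Prod>j\<in>UNIV. x $ j ^ (if j = i then 1 else 0)))"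
    by (rule box_poly_monomial) auto
  ultimately show ?case by auto
next
  case (add f g)
  then obtain d e where "box_poly d f" "box_poly e g" by blast
  then have "box_poly (max d e) f" "box_poly (max d e) g" by (auto intro: box_poly_mono)
  then show ?case using box_poly_add by blast
next
  case (mult f g)
  then show ?case using box_poly_mult by blast
qed

lemma box_poly_power: "box_poly d f \<Longrightarrow> box_poly (n * d) (\<lambda>x. f x ^ n)"
  by (induction n) (simp_all add: box_poly_const box_poly_mult)

lemma box_poly_prod:
  assumes "finite I" "\<And>i. i \<in> I \<Longrightarrow> box_poly d (f i)"
  shows "box_poly (card I * d) (\<lambda>x. \<Prod>i\<in>I. f i x)"
  using assms by (induction I rule: finite_induct) (simp_all add: box_poly_const box_poly_mult)

text \<open>Monomials in the components of F and in p with exponents up to D lie in a space whose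
  dimension grows like D to the power k, while their number grows like D to the power k + 1.\<close>

lemma algebraic_dependence:
  fixes F :: "complex ^ 'k \<Rightarrow> complex ^ 'k" and p :: "complex ^ 'k \<Rightarrow> complex"
  assumes F: "\<And>i. cpoly (\<lambda>x. F x $ i)" and p: "cpoly p"
  shows "\<exists>D q. (\<forall>j. cpoly (q j)) \<and> (\<exists>j\<le>D. \<exists>y. q j y \<noteq> 0) \<and>
    (\<forall>x. (\<Sum>j\<le>D. q j (F x) * p x ^ j) = 0)"
proof -
  let ?K = "CARD('k)"
  have "\<forall>i. \<exists>d. box_poly d (\<lambda>x. F x $ i)" using F cpoly_imp_box_poly by blast
  then obtain dF where dF: "\<And>i. box_poly (dF i) (\<lambda>x. F x $ i)" by metis
  obtain dp where dp: "box_poly dp p" using p cpoly_imp_box_poly by blast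
  define d where "d = (\<Sum>i\<in>UNIV. dF i) + dp"
  have "dF i \<le> d" for i
    unfolding d_def by (rule trans_le_add1, rule member_le_sum) auto
  then have bF: "box_poly d (\<lambda>x. F x $ i)" for i using dF box_poly_mono by blast
  have bp: "box_poly d p" using dp by (rule box_poly_mono) (simp add: d_def)
  \<comment> \<open>This \<open>m\<close> gives \<open>E + 1 \<le> m * (D + 1)\<close>. With
    \<open>D = m ^ CARD('k)\<close> there are then at most \<open>D * (D + 1) ^ CARD('k)\<close>
    monomials, fewer than the \<open>(D + 1) ^ (CARD('k) + 1)\<close> products
    \<open>h u\<close>.\<close>
  define m where "m = (?K + 1) * d + 1"
  define D where "D = m ^ ?K"
  define E where "E = ?K * (D * d) + D * d"
  define h where "h = (\<lambda>(\<alpha>, j) x. (\<Prod>i\<in>UNIV. F x $ i ^ \<alpha> i) * p x ^ j)"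
  let ?B = "(UNIV :: 'k set) \<rightarrow>\<^sub>E {..D}"
  let ?J = "(UNIV :: 'k set) \<rightarrow>\<^sub>E {..E}"
  let ?I = "?B \<times> {..D}"
  have "box_poly E (h u)" if uI: "u \<in> ?I" for u
  proof -
    obtain \<alpha> j where u: "u = (\<alpha>, j)" "\<forall>i. \<alpha> i \<le> D" "j \<le> D"
      using uI by (cases u) (auto simp: PiE_iff)
    have "box_poly (D * d) (\<lambda>x. F x $ i ^ \<alpha> i)" for i
      by (rule box_poly_mono[OF box_poly_power[OF bF]]) (simp add: u)
    then have 1: "box_poly (?K * (D * d)) (\<lambda>x. \<Prod>i\<in>UNIV. F x $ i ^ \<alpha> i)"
      by (intro box_poly_prod) auto
    have "box_poly (D * d) (\<lambda>x. p x ^ j)"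
      by (rule box_poly_mono[OF box_poly_power[OF bp]]) (simp add: u)
    from box_poly_mult[OF 1 this] show ?thesis by (simp add: h_def u E_def)
  qed
  then have "\<forall>u\<in>?I. \<exists>a. \<forall>x. h u x = (\<Sum>\<beta>\<in>?J. a \<beta> * (\<Prod>i\<in>UNIV. x $ i ^ \<beta> i))"
    unfolding box_poly_def by blast
  from bchoice[OF this] obtain a
    where a: "\<And>u x. u \<in> ?I \<Longrightarrow> h u x = (\<Sum>\<beta>\<in>?J. a u \<beta> * (\<Prod>i\<in>UNIV. x $ i ^ \<beta> i))"
    by blast
  have "card ?J = (E + 1) ^ ?K" by (simp add: card_PiE)
  also have "\<dots> \<le> (m * (D + 1)) ^ ?K"
    by (intro power_mono) (auto simp: E_def m_def algebra_simps)
  also have "\<dots> = D * (D + 1) ^ ?K" by (subst power_mult_distrib) (simp add: D_def)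
  also have "\<dots> < (D + 1) * (D + 1) ^ ?K" by simp
  also have "\<dots> = card ?I" by (simp add: card_cartesian_product card_PiE)
  finally have "card ?J < card ?I" .
  \<comment> \<open>The unknowns are the weights of the products \<open>h u\<close>; each monomial
    in \<open>x\<close> contributes one equation.\<close>
  from homogeneous_system_nontrivial[OF finite_box _ this, of a] obtain c where
    c: "\<exists>u\<in>?I. c u \<noteq> 0" "\<And>\<beta>. \<beta> \<in> ?J \<Longrightarrow> (\<Sum>u\<in>?I. c u * a u \<beta>) = 0"
    by (auto simp: finite_box)
  define q where "q j y = (\<Sum>\<alpha>\<in>?B. c (\<alpha>, j) * (\<Prod>i\<in>UNIV. y $ i ^ \<alpha> i))" for j and y :: "complex ^ 'k"
  have "(\<Sum>j\<le>D. q j (F x) * p x ^ j) = 0" for x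
  proof -
    have "(\<Sum>j\<le>D. q j (F x) * p x ^ j) = (\<Sum>j\<le>D. \<Sum>\<alpha>\<in>?B. c (\<alpha>, j) * h (\<alpha>, j) x)"
      by (simp add: q_def h_def sum_distrib_right mult.assoc)
    also have "\<dots> = (\<Sum>u\<in>?I. c u * h u x)"
      by (subst sum.swap) (simp add: sum.cartesian_product case_prod_unfold)
    also have "\<dots> = (\<Sum>u\<in>?I. \<Sum>\<beta>\<in>?J. (c u * a u \<beta>) * (\<Prod>i\<in>UNIV. x $ i ^ \<beta> i))"
      by (intro sum.cong refl) (simp add: a sum_distrib_left mult.assoc)
    also have "\<dots> = (\<Sum>\<beta>\<in>?J. (\<Sum>u\<in>?I. c u * a u \<beta>) * (\<Prod>i\<in>UNIV. x $ i ^ \<beta> i))"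
      by (subst sum.swap) (simp add: sum_distrib_right)
    also have "\<dots> = 0" using c(2) by (intro sum.neutral) simp
    finally show ?thesis .
  qed
  moreover have "cpoly (q j)" for j
    unfolding q_def by (intro cpoly_sum cpoly.mult cpoly.const cpoly_prod cpoly_power cpoly.coord)
  \<comment> \<open>The argument \<open>y\<close> of \<open>q j\<close> varies freely, unlike
    \<open>F x\<close>, so a nonzero weight \<open>c (\<alpha>, j)\<close> cannot be cancelled in
    \<open>q j\<close>.\<close>
  moreover have "\<exists>j\<le>D. \<exists>y. q j y \<noteq> 0"
  proof (rule ccontr)
    assume neg: "\<not> ?thesis"
    obtain \<alpha> j where \<alpha>: "\<alpha> \<in> ?B" "j \<le> D" "c (\<alpha>, j) \<noteq> 0" using c(1) by auto
    have "(\<Sum>\<alpha>\<in>?B. c (\<alpha>, j) * (\<Prod>i\<in>UNIV. x i ^ \<alpha> i)) = 0" for x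
      using neg \<alpha>(2) q_def[of j "\<chi> i. x i"] by auto
    then have "c (\<alpha>, j) = 0" by (rule monomials_independent[OF finite _ \<alpha>(1)])
    then show False using \<alpha> by simp
  qed
  ultimately show ?thesis by blast
qed

section \<open>Values of square polynomial maps\<close>

text \<open>A Cauchy type root bound: for \<open>norm z > 1\<close> every lower term is dominated by
  the power of degree \<open>n - 1\<close>. The bound depends on the coefficients alone, and
  continuously where \<open>c n\<close> is nonzero.\<close>

lemma norm_root_le:
  fixes z :: "'a::real_normed_field"
  assumes "(\<Sum>j\<le>n. c j * z ^ j) = 0" "c n \<noteq> 0"
  shows "norm z \<le> 1 + (\<Sum>j\<le>n. norm (c j) / norm (c n))"
proof (cases "norm z \<le> 1")
  case True
  then show ?thesis by (simp add: add_increasing2 sum_nonneg)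
next
  case False
  \<comment> \<open>The case \<open>n = 0\<close> is impossible, since the equation would read
    \<open>c 0 = 0\<close>.\<close>
  obtain m where n: "n = Suc m" using assms by (cases n) auto
  have "c n * z ^ n = - (\<Sum>j\<le>m. c j * z ^ j)"
    using assms(1) by (simp add: n eq_neg_iff_add_eq_0 add.commute)
  then have "norm (c n) * norm z ^ n = norm (\<Sum>j\<le>m. c j * z ^ j)"
    by (metis norm_minus_cancel norm_mult norm_power)
  also have "\<dots> \<le> (\<Sum>j\<le>m. norm (c j) * norm z ^ j)"
    by (rule order_trans[OF norm_sum]) (simp add: norm_mult norm_power)
  also have "\<dots> \<le> (\<Sum>j\<le>m. norm (c j) * norm z ^ m)"
    using False by (intro sum_mono mult_left_mono power_increasing) auto
  also have "\<dots> \<le> (\<Sum>j\<le>n. norm (c j)) * norm z ^ m"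
    by (simp add: n sum_distrib_right[symmetric] distrib_right)
  finally have "(norm (c n) * norm z) * norm z ^ m \<le> (\<Sum>j\<le>n. norm (c j)) * norm z ^ m"
    by (simp add: n mult_ac)
  moreover have "norm z ^ m > 0" using False by (intro zero_less_power) linarith
  ultimately have "norm (c n) * norm z \<le> (\<Sum>j\<le>n. norm (c j))" by simp
  then have "norm z \<le> (\<Sum>j\<le>n. norm (c j)) / norm (c n)"
    using assms(2) by (simp add: pos_le_divide_eq mult.commute)
  then show ?thesis by (simp add: sum_divide_distrib[symmetric])
qed

lemma cpoly_compose:
  assumes "cpoly q" "\<And>i. cpoly (\<lambda>x. F x $ i)"
  shows "cpoly (\<lambda>x. q (F x))"
  using assms(1) by induction (use assms(2) in \<open>simp_all add: cpoly.intros\<close>)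

text \<open>By algebraic dependence \<open>p x\<close> is a root of a polynomial whose coefficients
  depend only on \<open>F x\<close>. Where the highest coefficient that is not identically zero does
  not vanish, the root bound is uniform near \<open>y\<close>. With the coordinates as
  \<open>p\<close>, this is properness of \<open>F\<close> over a generic set.\<close>

lemma cpoly_bounded_over_image:
  fixes F :: "complex ^ 'k \<Rightarrow> complex ^ 'k"
  assumes F: "\<And>i. cpoly (\<lambda>x. F x $ i)" and p: "cpoly p"
  shows "\<exists>a. cpoly a \<and> (\<exists>y. a y \<noteq> 0) \<and>
    (\<forall>y. a y \<noteq> 0 \<longrightarrow> (\<exists>M. \<forall>\<^sub>F z in nhds y. \<forall>x. F x = z \<longrightarrow> norm (p x) \<le> M))"
proof -
  obtain D q where q: "\<And>j. cpoly (q j)" "\<exists>j\<le>D. \<exists>y. q j y \<noteq> 0"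
    "\<And>x. (\<Sum>j\<le>D. q j (F x) * p x ^ j) = 0"
    using algebraic_dependence[OF F p] by blast
  let ?J = "{j. j \<le> D \<and> (\<exists>y. q j y \<noteq> 0)}"
  define n where "n = Max ?J"
  have "n \<in> ?J" unfolding n_def using q(2) by (intro Max_in) auto
  then have n: "n \<le> D" "\<exists>y. q n y \<noteq> 0" by auto
  have above: "q j y = 0" if "n < j" "j \<le> D" for j y
  proof (rule ccontr)
    assume "q j y \<noteq> 0"
    then have "j \<le> n" unfolding n_def using that by (intro Max_ge) auto
    then show False using that by simp
  qed
  have zero: "(\<Sum>j\<le>n. q j (F x) * p x ^ j) = 0" for x
  proof -
    have "(\<Sum>j\<le>n. q j (F x) * p x ^ j) = (\<Sum>j\<le>D. q j (F x) * p x ^ j)"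
      using n(1) above by (intro sum.mono_neutral_left) auto
    then show ?thesis using q(3) by simp
  qed
  define B where "B y = 1 + (\<Sum>j\<le>n. norm (q j y) / norm (q n y))" for y
  have cont: "isCont (q j) y" for j y
    using cpoly_continuous[OF q(1), of UNIV j] by (simp add: continuous_on_eq_continuous_at)
  have "\<exists>M. \<forall>\<^sub>F z in nhds y. \<forall>x. F x = z \<longrightarrow> norm (p x) \<le> M" if y: "q n y \<noteq> 0" for y
  proof -
    have "isCont B y" unfolding B_def using y by (intro continuous_intros cont) auto
    then have "\<forall>\<^sub>F z in nhds y. B z < B y + 1"
      by (intro order_tendstoD(2)[where y = "B y"]) (auto simp: isCont_def tendsto_at_iff_tendsto_nhds)
    moreover have "\<forall>\<^sub>F z in nhds y. q n z \<noteq> 0"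
      using cont[of y n] y by (intro tendsto_imp_eventually_ne[where c = "q n y"])
        (auto simp: isCont_def tendsto_at_iff_tendsto_nhds)
    ultimately have "\<forall>\<^sub>F z in nhds y. \<forall>x. F x = z \<longrightarrow> norm (p x) \<le> B y + 1"
    proof eventually_elim
      case (elim z)
      show ?case
      proof (intro allI impI)
        fix x assume "F x = z"
        then have "norm (p x) \<le> B z"
          using norm_root_le[OF zero[of x]] elim by (simp add: B_def)
        then show "norm (p x) \<le> B y + 1" using elim by linarith
      qed
    qed
    then show ?thesis by blast
  qed
  then show ?thesis using q(1) n(2) by blast
qed

text \<open>The counterpart with the lowest coefficient: after a power of \<open>p\<close> is
  cancelled, the relation at a zero of \<open>p\<close> reduces to its constant term
  \<open>q n (F x) = 0\<close>, so \<open>b = q n\<close> works.\<close>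

lemma cpoly_nonzero_over_image:
  fixes F :: "complex ^ 'k \<Rightarrow> complex ^ 'k"
  assumes F: "\<And>i. cpoly (\<lambda>x. F x $ i)" and p: "cpoly p" "p w \<noteq> 0"
  shows "\<exists>b. cpoly b \<and> (\<exists>y. b y \<noteq> 0) \<and> (\<forall>x. b (F x) \<noteq> 0 \<longrightarrow> p x \<noteq> 0)"
proof -
  obtain D q where q: "\<And>j. cpoly (q j)" "\<exists>j\<le>D. \<exists>y. q j y \<noteq> 0"
    "\<And>x. (\<Sum>j\<le>D. q j (F x) * p x ^ j) = 0"
    using algebraic_dependence[OF F p(1)] by blast
  define n where "n = (LEAST j. j \<le> D \<and> (\<exists>y. q j y \<noteq> 0))"
  have n: "n \<le> D" "\<exists>y. q n y \<noteq> 0"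
    using LeastI_ex[of "\<lambda>j. j \<le> D \<and> (\<exists>y. q j y \<noteq> 0)"] q(2) unfolding n_def by blast+
  have below: "q j y = 0" if "j < n" for j y
    using not_less_Least[OF that[unfolded n_def]] n(1) that by auto
  define s where "s x = (\<Sum>j\<le>D - n. q (n + j) (F x) * p x ^ j)" for x
  have "p x ^ n * s x = 0" for x
  proof -
    have "p x ^ n * s x = (\<Sum>j\<le>D - n. q (n + j) (F x) * p x ^ (n + j))"
      by (simp add: s_def sum_distrib_left power_add mult_ac)
    also have "\<dots> = (\<Sum>j\<in>{n..D}. q j (F x) * p x ^ j)"
      using n(1) by (intro sum.reindex_bij_witness[where i = "\<lambda>j. j - n" and j = "\<lambda>j. n + j"]) auto
    also have "\<dots> = (\<Sum>j\<le>D. q j (F x) * p x ^ j)"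
      using below by (intro sum.mono_neutral_left) auto
    finally show ?thesis using q(3) by simp
  qed
  moreover have "cpoly s" unfolding s_def
    by (intro cpoly_sum cpoly.mult cpoly_power p cpoly_compose[OF q(1) F])
  \<comment> \<open>Cancelling \<open>p ^ n\<close> is legitimate because \<open>p\<close> is
    nonzero at \<open>w\<close>.\<close>
  ultimately have s0: "s x = 0" for x
    using cpoly_mult_zero[OF cpoly_power[OF p(1), of n]] p(2) by auto
  have "q n (F x) = 0" if "p x = 0" for x
  proof -
    have "s x = (\<Sum>j\<le>D - n. if j = 0 then q n (F x) else 0)"
      unfolding s_def using that by (intro sum.cong) auto
    then show ?thesis using s0 by simp
  qed
  then show ?thesis using q(1) n(2) by blast
qed

lemma has_derivative_vecI:
  fixes f :: "'a::real_normed_vector \<Rightarrow> 'b::euclidean_space ^ 'k"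
  assumes "\<And>i. ((\<lambda>x. f x $ i) has_derivative (\<lambda>v. f' v $ i)) (at x within S)"
  shows "(f has_derivative f') (at x within S)"
proof (subst has_derivative_componentwise_within, intro ballI)
  fix b :: "'b ^ 'k" assume "b \<in> Basis"
  then obtain i u where b: "b = axis i u" by (auto simp: Basis_vec_def)
  show "((\<lambda>x. f x \<bullet> b) has_derivative (\<lambda>v. f' v \<bullet> b)) (at x within S)"
    unfolding b inner_axis by (intro has_derivative_inner_left assms)
qed

lemma open_map_at_invertible_derivative:
  fixes F :: "complex ^ 'k \<Rightarrow> complex ^ 'k"
  assumes "continuous_on UNIV F" "(F has_derivative (*v) M) (at x)" "det M \<noteq> 0"
  shows "F x \<in> interior (range F)"
proof -
  obtain M' where M': "M ** M' = mat 1"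
    using assms(3) by (auto simp: invertible_det_nz[symmetric] invertible_def)
  show ?thesis
  proof (rule sussmann_open_mapping[where S = UNIV and g' = "(*v) M'"])
    show "(*v) M \<circ> (*v) M' = id"
      by (auto simp: fun_eq_iff matrix_vector_mul_assoc M')
  qed (use assms in auto)
qed

text \<open>Over the set g \<noteq> 0 the range of F is relatively closed, because the coordinates of preimages
  stay bounded, and open, because the Jacobian does not vanish on preimages. That set is
  connected, as every complex line meets its complement in finitely many points or lies in it.\<close>

theorem polynomial_map_range_contains_generic:
  fixes F :: "complex ^ 'k \<Rightarrow> complex ^ 'k"
  assumes F: "\<And>i. cpoly (\<lambda>x. F x $ i)"
    and L: "\<And>i. ((\<lambda>x. F x $ i) has_derivative L i) (at x0)"
    and inj: "\<And>v. (\<And>i. L i v = 0) \<Longrightarrow> v = 0"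
  shows "\<exists>g. cpoly g \<and> (\<exists>y. g y \<noteq> 0) \<and> {y. g y \<noteq> 0} \<subseteq> range F"
proof -
  have contF: "continuous_on S F" for S
    
    using continuous_on_vec_lambda[of S "\<lambda>i x. F x $ i"] cpoly_continuous[OF F] by simp
  have "\<forall>i. \<exists>f'. (\<forall>j. cpoly (f' j)) \<and>
      (\<forall>x. ((\<lambda>x. F x $ i) has_derivative (\<lambda>v. \<Sum>j\<in>UNIV. f' j x * v $ j)) (at x))"
    using cpoly_has_derivative[OF F] by blast
  from choice[OF this] obtain F' where F': "\<And>i j. cpoly (F' i j)"
    "\<And>i x. ((\<lambda>x. F x $ i) has_derivative (\<lambda>v. \<Sum>j\<in>UNIV. F' i j x * v $ j)) (at x)"
    by blast
  define Jac where "Jac x = (\<chi> i j. F' i j x)" for x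
  have der: "(F has_derivative (*v) (Jac x)) (at x)" for x
    by (rule has_derivative_vecI) (use F'(2) in \<open>simp add: Jac_def matrix_vector_mult_def\<close>)
  have "Jac x0 *v v = 0 \<Longrightarrow> v = 0" for v
  proof -
    assume v: "Jac x0 *v v = 0"
    \<comment> \<open>\<open>L\<close> is whatever form of the derivative is convenient for the
      application; uniqueness identifies it with a row of the Jacobian matrix.\<close>
    have "L i = (\<lambda>v. \<Sum>j\<in>UNIV. F' i j x0 * v $ j)" for i
      by (rule has_derivative_unique[OF L F'(2)])
    then have "L i v = (Jac x0 *v v) $ i" for i by (simp add: Jac_def matrix_vector_mult_def)
    with v show "v = 0" using inj by simp
  qed
  then have "inj ((*v) (Jac x0))" by (simp add: vec.inj_iff_eq_0)
  then have J0: "det (Jac x0) \<noteq> 0"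
    by (metis invertible_det_nz invertible_left_inverse matrix_left_invertible_injective)
  have cJ: "cpoly (\<lambda>x. det (Jac x))"
    by (rule cpoly_det) (simp add: Jac_def F')
  obtain b where b: "cpoly b" "\<exists>y. b y \<noteq> 0" "\<And>x. b (F x) \<noteq> 0 \<Longrightarrow> det (Jac x) \<noteq> 0"
    using cpoly_nonzero_over_image[OF F cJ J0] by blast
  have "\<forall>i. \<exists>a. cpoly a \<and> (\<exists>y. a y \<noteq> 0) \<and>
      (\<forall>y. a y \<noteq> 0 \<longrightarrow> (\<exists>M. \<forall>\<^sub>F z in nhds y. \<forall>x. F x = z \<longrightarrow> norm (x $ i) \<le> M))"
    using cpoly_bounded_over_image[OF F cpoly.coord] by blast
  from choice[OF this] obtain a where a: "\<And>i. cpoly (a i)" "\<And>i. \<exists>y. a i y \<noteq> 0"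
    "\<And>i y. a i y \<noteq> 0 \<Longrightarrow> \<exists>M. \<forall>\<^sub>F z in nhds y. \<forall>x. F x = z \<longrightarrow> norm (x $ i) \<le> M" by blast
  \<comment> \<open>The factor \<open>b\<close> makes every preimage a regular point; the factors
    \<open>a i\<close> together confine all preimages of nearby values to one ball.\<close>
  define g where "g y = b y * (\<Prod>i\<in>UNIV. a i y)" for y
  have cg: "cpoly g" unfolding g_def by (intro cpoly.mult b cpoly_prod a)
  have cA: "cpoly (\<lambda>y. \<Prod>i\<in>UNIV. a i y)" by (intro cpoly_prod a)
  have nz: "\<exists>y. g y \<noteq> 0"
  proof -
    have "\<exists>z. (\<Prod>i\<in>UNIV. a i z) \<noteq> 0" by (rule cpoly_prod_nonzero) (use a in auto)
    then obtain y z where "b y \<noteq> 0" "(\<Prod>i\<in>UNIV. a i z) \<noteq> 0" using b(2) by blast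
    then show ?thesis unfolding g_def
      using cpoly_mult_zero[OF b(1) cA, of y z] by auto
  qed
  have opn: "y \<in> interior (range F)" if "g y \<noteq> 0" "y \<in> range F" for y
    using that open_map_at_invertible_derivative[OF contF der] b(3) by (auto simp: g_def)
  have cls: "y \<in> range F" if gy: "g y \<noteq> 0" and y: "y \<in> closure (range F)" for y
  proof -
    have "\<forall>i. \<exists>M. \<forall>\<^sub>F z in nhds y. \<forall>x. F x = z \<longrightarrow> norm (x $ i) \<le> M"
      using a(3) gy by (auto simp: g_def)
    from choice[OF this] obtain M where
      M: "\<And>i. \<forall>\<^sub>F z in nhds y. \<forall>x. F x = z \<longrightarrow> norm (x $ i) \<le> M i" by blast
    define K where "K = cball (0 :: complex ^ 'k) (\<Sum>i\<in>UNIV. M i)"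
    have "\<forall>\<^sub>F z in nhds y. \<forall>i. \<forall>x. F x = z \<longrightarrow> norm (x $ i) \<le> M i"
      by (rule eventually_all_finite) (rule M)
    then have ev: "\<forall>\<^sub>F z in nhds y. \<forall>x. F x = z \<longrightarrow> x \<in> K"
    proof eventually_elim
      case (elim z)
      show ?case
      proof (intro allI impI)
        fix x assume "F x = z"
        then have "(\<Sum>i\<in>UNIV. norm (x $ i)) \<le> (\<Sum>i\<in>UNIV. M i)"
          using elim by (intro sum_mono) auto
        moreover have "norm x \<le> (\<Sum>i\<in>UNIV. norm (x $ i))"
          unfolding norm_vec_def by (rule L2_set_le_sum) simp
        ultimately have "norm x \<le> (\<Sum>i\<in>UNIV. M i)" by linarith
        then show "x \<in> K" by (simp add: K_def)
      qed
    qed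
    then obtain S where S: "open S" "y \<in> S" "\<And>x. F x \<in> S \<Longrightarrow> x \<in> K"
      unfolding eventually_nhds by blast
    \<comment> \<open>Near \<open>y\<close> the range consists of values on the compact ball
      \<open>K\<close>. The image of \<open>K\<close> is closed, so \<open>y\<close> itself is
      attained.\<close>
    have "y \<in> closure (F ` K)"
    proof (subst closure_iff_nhds_not_empty, intro allI impI)
      fix A V assume "V \<subseteq> A" "y \<in> V" "open V"
      then have "V \<inter> S \<inter> range F \<noteq> {}" 
        using y S(1,2) by (metis IntI closure_iff_nhds_not_empty open_Int subset_refl inf_commute)
      then show "F ` K \<inter> A \<noteq> {}" using S(3) \<open>V \<subseteq> A\<close> by blast
    qed
    moreover have "compact (F ` K)" by (intro compact_continuous_image contF) (simp add: K_def)
    then have "closure (F ` K) = F ` K" by (simp add: compact_imp_closed)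
    ultimately show ?thesis by blast
  qed
  have "F x0 \<in> interior (range F)" using open_map_at_invertible_derivative[OF contF der J0] .
  then obtain e where e: "e > 0" "ball (F x0) e \<subseteq> range F" by (auto simp: mem_interior)
  \<comment> \<open>The connectedness argument needs one attained value off the zero set:
    \<open>F x0\<close> is interior to the range, and \<open>g\<close> cannot vanish on a whole
    ball.\<close>
  obtain y0 where y0: "y0 \<in> range F" "g y0 \<noteq> 0"
  proof -
    obtain y1 where "g y1 \<noteq> 0" using nz by blast
    from cpoly_nonzero_near[OF cg this e(1), of "F x0"] obtain y' where
      "dist y' (F x0) < e" "g y' \<noteq> 0" by blast
    then show ?thesis using e(2) that by (auto simp: dist_commute subset_iff)
  qed
  have "y \<in> range F" if gy: "g y \<noteq> 0" for y
  proof -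
    define l where "l t = y0 + t *s (y - y0)" for t
    obtain q where q: "\<And>t. g (l t) = poly q t" using cpoly_line[OF cg] unfolding l_def by metis
    have contl: "continuous_on X l" for X unfolding l_def
      by (auto simp: vector_scalar_mult_def plus_vec_def intro!: continuous_intros)
    define T where "T = {t. g (l t) \<noteq> 0}"
    have "poly q 0 \<noteq> 0" using q[of 0] y0 by (simp add: l_def)
    then have "countable {t. poly q t = 0}"
      by (intro countable_finite poly_roots_finite) auto
    \<comment> \<open>The real dimension two of the complex plane enters here; a real line would be
      disconnected by a single root.\<close>
    then have "connected (UNIV - {t. poly q t = 0})"
      by (intro connected_open_diff_countable) auto
    moreover have "UNIV - {t. poly q t = 0} = T" by (auto simp: T_def q)
    ultimately have "connected T" by simp
    moreover have "openin (top_of_set T) {t \<in> T. l t \<in> range F}"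
    proof -
      have "{t \<in> T. l t \<in> range F} = T \<inter> l -` interior (range F)"
        using opn interior_subset by (auto simp: T_def)
      then show ?thesis using continuous_openin_preimage_gen[OF contl open_interior] by metis
    qed
    moreover have "closedin (top_of_set T) {t \<in> T. l t \<in> range F}"
    proof -
      have "{t \<in> T. l t \<in> range F} = T \<inter> l -` closure (range F)"
        using cls closure_subset[of "range F"] by (auto simp: T_def)
      then show ?thesis using continuous_closedin_preimage[OF contl closed_closure] by metis
    qed
    ultimately have "{t \<in> T. l t \<in> range F} = {} \<or> {t \<in> T. l t \<in> range F} = T"
      unfolding connected_clopen by blast
    moreover have "0 \<in> {t \<in> T. l t \<in> range F}" using y0 by (simp add: T_def l_def)
    moreover have "1 \<in> T" using gy by (simp add: T_def l_def)
    ultimately have "l 1 \<in> range F" by blast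
    then show ?thesis by (simp add: l_def)
  qed
  then show ?thesis using cg nz by blast
qed

section \<open>Zero sets have measure zero\<close>

text \<open>Fubini by induction: for almost every choice of the other coordinates the slice in
  coordinate \<open>i\<close> is a nonzero polynomial, so it vanishes at finitely many reals
  only.\<close>

lemma null_zero_set_PiM:
  fixes p :: "('i \<Rightarrow> real) \<Rightarrow> complex"
  assumes "finite I" "p \<in> borel_measurable (\<Pi>\<^sub>M i\<in>I. lborel)"
    and "\<And>x i. i \<in> I \<Longrightarrow> \<exists>q. \<forall>t. p (x(i := t)) = poly q (of_real t)"
    and "x0 \<in> space (\<Pi>\<^sub>M i\<in>I. (lborel :: real measure))" "p x0 \<noteq> 0"
  shows "{x \<in> space (\<Pi>\<^sub>M i\<in>I. lborel). p x = 0} \<in> null_sets (\<Pi>\<^sub>M i\<in>I. lborel)"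
  using assms
proof (induction I arbitrary: p x0 rule: finite_induct)
  case empty
  then have "{x \<in> space (\<Pi>\<^sub>M i\<in>{}. (lborel :: real measure)). p x = 0} = {}"
    by (auto simp: space_PiM)
  then show ?case by (simp only:) simp
next
  case (insert i I)
  interpret product_sigma_finite "\<lambda>_::'i. lborel :: real measure" ..
  let ?M = "\<Pi>\<^sub>M i\<in>I. (lborel :: real measure)"
  let ?M' = "\<Pi>\<^sub>M i\<in>insert i I. (lborel :: real measure)"
  let ?Z = "{x \<in> space ?M'. p x = 0}"
  \<comment> \<open>Freezing coordinate \<open>i\<close> at its value in \<open>x0\<close> leaves a
    function that is nonzero at the restriction of \<open>x0\<close>, as the induction hypothesis
    requires.\<close>
  define p' where "p' x = p (x(i := x0 i))" for x
  have Z: "?Z \<in> sets ?M'" using insert.prems(1) by measurable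
  have "{x \<in> space ?M. p' x = 0} \<in> null_sets ?M"
  proof (rule insert.IH)
    have "(\<lambda>x. x(i := x0 i)) \<in> measurable ?M ?M'"
      by (rule measurable_fun_upd[where J = I]) auto
    then show "p' \<in> borel_measurable ?M"
      unfolding p'_def using insert.prems(1) by (rule measurable_compose)
    show "\<exists>q. \<forall>t. p' (x(j := t)) = poly q (of_real t)" if "j \<in> I" for x j
    proof -
      have "x(j := t, i := x0 i) = x(i := x0 i, j := t)" for t
        using that insert.hyps by (intro fun_upd_twist) auto
      then show ?thesis using insert.prems(2)[of j "x(i := x0 i)"] that by (simp only: p'_def) blast
    qed
    show "restrict x0 I \<in> space ?M" using insert.prems(3) by (auto simp: space_PiM)
    have "(restrict x0 I)(i := x0 i) = x0"
      using insert.prems(3) by (auto simp: space_PiM fun_eq_iff PiE_iff extensional_def)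
    then show "p' (restrict x0 I) \<noteq> 0" using insert.prems(4) by (simp add: p'_def)
  qed
  then have AE: "AE x in ?M. p' x \<noteq> 0" by (rule AE_I') auto
  have inner: "(\<integral>\<^sup>+ y. indicator ?Z (x(i := y)) \<partial>lborel) = 0" if "p' x \<noteq> 0" for x
  proof -
    obtain q where q: "\<And>t. p (x(i := t)) = poly q (of_real t)" using insert.prems(2) by blast
    have "q \<noteq> 0" using that q[of "x0 i"] by (auto simp: p'_def)
    then have "finite (of_real -` {z. poly q z = 0} :: real set)"
      by (intro finite_vimageI poly_roots_finite) (auto simp: inj_on_def)
    then have "countable {t. p (x(i := t)) = 0}"
      by (intro countable_finite) (simp add: q vimage_def)
    then have "AE y in lborel. y \<notin> {t. p (x(i := t)) = 0}"
      by (intro AE_not_in countable_imp_null_set_lborel)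
    then have "AE y in lborel. indicator ?Z (x(i := y)) = (0 :: ennreal)"
      by eventually_elim (auto simp: indicator_def)
    then show ?thesis by (subst nn_integral_cong_AE) auto
  qed
  have "emeasure ?M' ?Z = (\<integral>\<^sup>+ x. indicator ?Z x \<partial>?M')" using Z by simp
  also have "\<dots> = (\<integral>\<^sup>+ x. (\<integral>\<^sup>+ y. indicator ?Z (x(i := y)) \<partial>lborel) \<partial>?M)"
    using Z insert.hyps by (intro product_nn_integral_insert) auto
  also have "\<dots> = (\<integral>\<^sup>+ x. 0 \<partial>?M)"
    using AE inner by (intro nn_integral_cong_AE) auto
  finally show ?case using Z by (simp add: null_sets_def)
qed

text \<open>In orthonormal coordinates, changing one coordinate is a move along a line, so
  polynomiality on lines yields polynomiality in each coordinate. The null set is then carried over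
  by \<open>distr\<close> and the completion.\<close>

lemma null_zero_set_subspace:
  fixes g :: "'a::euclidean_space \<Rightarrow> complex"
  assumes S: "subspace S" and cont: "continuous_on UNIV g"
    and line: "\<And>x d. \<exists>q. \<forall>t::real. g (x + t *\<^sub>R d) = poly q (of_real t)"
    and x0: "x0 \<in> S" "g x0 \<noteq> 0"
  shows "{x \<in> S. g x = 0} \<in> null_sets (subspace_lebesgue S)"
proof -
  let ?B = "onb S"
  let ?M = "\<Pi>\<^sub>M b\<in>?B. (lborel :: real measure)"
  let ?Z = "{x \<in> S. g x = 0}"
  define h where "h c = (\<Sum>b\<in>?B. c b *\<^sub>R b)" for c :: "'a \<Rightarrow> real"
  have B: "finite ?B" "span ?B = S"
    using is_onb_onb[OF S] pairwise_orthogonal_imp_finite unfolding is_onb_def by auto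
  have h: "h \<in> measurable ?M (restrict_space borel S)"
    unfolding h_def by (rule measurable_onb_coords[OF S])
  have hS: "h c \<in> S" for c
  proof -
    have "h c \<in> span ?B" unfolding h_def by (intro span_sum span_scale span_base)
    then show ?thesis by (simp add: B)
  qed
  have gm: "g \<in> borel_measurable borel" using cont by (rule borel_measurable_continuous_onI)
  have Z: "?Z \<in> sets (restrict_space borel S)"
  proof -
    have "?Z = S \<inter> (g -` {0} \<inter> space borel)" by auto
    moreover have "g -` {0} \<inter> space borel \<in> sets borel" by (rule measurable_sets[OF gm]) simp
    ultimately show ?thesis unfolding sets_restrict_space by (rule image_eqI)
  qed
  obtain u where u: "x0 = h u"
    using x0(1) span_finite[OF B(1)] B(2) unfolding h_def by auto
  have "{c \<in> space ?M. (g \<circ> h) c = 0} \<in> null_sets ?M"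
  proof (rule null_zero_set_PiM[OF B(1)])
    show "g \<circ> h \<in> borel_measurable ?M"
      using measurable_restrict_space2_iff h gm by (metis measurable_comp)
    show "\<exists>q. \<forall>t. (g \<circ> h) (c(b := t)) = poly q (of_real t)" if b: "b \<in> ?B" for c b
    proof -
      define y where "y = h (c(b := 0))"
      have "h (c(b := t)) = y + t *\<^sub>R b" for t
        unfolding y_def h_def using sum.remove[OF B(1) b, of "\<lambda>b'. (c(b := t)) b' *\<^sub>R b'"]
          sum.remove[OF B(1) b, of "\<lambda>b'. (c(b := 0)) b' *\<^sub>R b'"] by simp
      then show ?thesis using line[of y b] by simp
    qed
    show "restrict u ?B \<in> space ?M" by (auto simp: space_PiM)
    have "h (restrict u ?B) = h u" unfolding h_def by (intro sum.cong) auto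
    then show "(g \<circ> h) (restrict u ?B) \<noteq> 0" using x0 u by simp
  qed
  moreover have "h -` ?Z \<inter> space ?M = {c \<in> space ?M. (g \<circ> h) c = 0}" using hS by auto
  ultimately have "?Z \<in> null_sets (distr ?M (restrict_space borel S) h)"
    using Z h by (simp add: null_sets_def emeasure_distr)
  then show ?thesis
    unfolding subspace_lebesgue_def subspace_lborel_def h_def by (rule null_sets_completionI)
qed

section \<open>The product map\<close>

text \<open>All terms of the sum are 0 or 1, so nothing cancels; real parts turn this into an
  inequality between nonnegative sums.\<close>

lemma nz_entries_mult:
  assumes "compatible A B" "A $ n $ m \<noteq> 0" "B $ m $ l \<noteq> 0"
  shows "(n, l) \<in> nz_entries (A ** B)"
proof -
  have AB: "A $ n $ k \<in> {0, 1}" "B $ k $ l \<in> {0, 1}" for k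
    using assms(1) unfolding compatible_def by auto
  have "A $ n $ m * B $ m $ l = 1" using AB[of m] assms(2,3) by auto
  then have "1 \<le> Re (A $ n $ m * B $ m $ l)" by simp
  also have "\<dots> \<le> (\<Sum>k\<in>UNIV. Re (A $ n $ k * B $ k $ l))"
  proof (rule member_le_sum)
    show "0 \<le> Re (A $ n $ k * B $ k $ l)" for k using AB[of k] by auto
  qed auto
  finally have "1 \<le> Re ((A ** B) $ n $ l)" by (simp add: matrix_matrix_mult_def)
  then show ?thesis by (auto simp: nz_entries_def)
qed

text \<open>The factor Y is the identity plus one free entry for every new entry (k, l) of the product,
  placed at row mu (k, l) of column l; X is unrestricted on the support of A. Off the support of
  A B the coordinates of P are kept, which makes the map square. Vectors indexed by pairs stand
  for matrices.\<close>

definition left_factor :: "complex ^ 'n ^ 'n \<Rightarrow> complex ^ ('n \<times> 'n) \<Rightarrow> complex ^ 'n ^ 'n" where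
  "left_factor A P = (\<chi> n m. if A $ n $ m \<noteq> 0 then P $ (n, m) else 0)"

definition right_part ::
    "('n \<times> 'n) set \<Rightarrow> ('n \<times> 'n \<Rightarrow> 'n) \<Rightarrow> complex ^ ('n \<times> 'n) \<Rightarrow> complex ^ 'n ^ 'n" where
  "right_part N mu P = (\<chi> m l. \<Sum>k\<in>UNIV. if (k, l) \<in> N \<and> mu (k, l) = m then P $ (k, l) else 0)"

text \<open>\<open>g\<close> is a polynomial in all entries, and a nonzero one may still vanish on
  the whole subspace of matrices supported on the product. The fixed shift \<open>W\<close>, built
  with support off that product, moves the subspace to a parallel copy on which \<open>g\<close> is
  not identically zero.\<close>

lemma generic_factorization:
  fixes A B :: "complex ^ 'n ^ 'n"
  assumes comp: "compatible A B" and simple: "simple_extension A B"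
  shows "\<exists>g W. cpoly g \<and> (\<exists>C\<in>spr (A ** B). g ((\<chi> k. C $ fst k $ snd k) + W) \<noteq> 0) \<and>
    (\<forall>C\<in>spr (A ** B). g ((\<chi> k. C $ fst k $ snd k) + W) \<noteq> 0 \<longrightarrow> C \<in> prod_range A B)"
proof -
  define S where "S = nz_entries (A ** B)"
  define N where "N = S - nz_entries A"
  have "\<exists>m. A $ n $ m \<noteq> 0 \<and> B $ m $ l \<noteq> 0" if "(n, l) \<in> N" for n l
  proof -
    have "(\<Sum>m\<in>UNIV. A $ n $ m * B $ m $ l) \<noteq> 0"
      using that by (simp add: N_def S_def nz_entries_def matrix_matrix_mult_def)
    then obtain m where "A $ n $ m * B $ m $ l \<noteq> 0" by (meson sum.neutral)
    then show ?thesis by auto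
  qed
  then have "\<forall>k\<in>N. \<exists>m. A $ fst k $ m \<noteq> 0 \<and> B $ m $ snd k \<noteq> 0" by auto
  from bchoice[OF this] obtain mu where
    mu: "\<And>n l. (n, l) \<in> N \<Longrightarrow> A $ n $ mu (n, l) \<noteq> 0" "\<And>n l. (n, l) \<in> N \<Longrightarrow> B $ mu (n, l) $ l \<noteq> 0"
    by fastforce
  \<comment> \<open>Both \<open>(n, l)\<close> and \<open>(n', l)\<close> are new entries served by
    the entry \<open>(mu (n', l), l)\<close> of \<open>B\<close>, which serves at most one.\<close>
  have uniq: "n = n'" if "(n, l) \<in> N" "(n', l) \<in> N" "A $ n $ mu (n', l) \<noteq> 0" for n n' l
  proof -
    let ?m = "mu (n', l)"
    have "card (new_entries A B ?m l) \<le> 1"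
      using simple mu(2)[OF that(2)] by (auto simp: simple_extension_def nz_entries_def)
    moreover have "(n, l) \<in> new_entries A B ?m l" "(n', l) \<in> new_entries A B ?m l"
      using that mu by (auto simp: new_entries_def N_def S_def)
    ultimately show ?thesis by (auto simp: card_le_Suc0_iff_eq)
  qed
  define Y where "Y P = mat 1 + right_part N mu P" for P
  define F where "F P = (\<chi> k. (left_factor A P ** Y P) $ fst k $ snd k + (if k \<in> S then 0 else P $ k))" for P
  have X_spr: "left_factor A P \<in> spr A" for P
    by (simp add: left_factor_def spr_def)
  have Y_spr: "Y P \<in> spr B" for P
  proof -
    have "Y P $ m $ l = 0" if "B $ m $ l = 0" for m l
    proof -
      have "m \<noteq> l" using comp that by (auto simp: compatible_def)
      moreover have "right_part N mu P $ m $ l = 0"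
        using mu(2) that by (auto simp: right_part_def intro!: sum.neutral)
      ultimately show ?thesis by (simp add: Y_def mat_def)
    qed
    then show ?thesis by (simp add: spr_def)
  qed
  have F: "F P $ (n, l) = (\<Sum>m\<in>UNIV. left_factor A P $ n $ m * Y P $ m $ l) +
      (if (n, l) \<in> S then 0 else P $ (n, l))" for P n l
    by (simp add: F_def matrix_matrix_mult_def)
  have cX: "cpoly (\<lambda>P. left_factor A P $ n $ m)" for n m
    by (cases "A $ n $ m = 0") (simp_all add: left_factor_def cpoly.const cpoly.coord)
  have cR: "cpoly (\<lambda>P. right_part N mu P $ m $ l)" for m l
    unfolding right_part_def vec_lambda_beta
  proof (rule cpoly_sum)
    show "cpoly (\<lambda>P. if (k, l) \<in> N \<and> mu (k, l) = m then P $ (k, l) else 0)" for k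
      by (cases "(k, l) \<in> N"; cases "mu (k, l) = m") (simp_all add: cpoly.const cpoly.coord)
  qed
  have cF: "cpoly (\<lambda>P. F P $ k)" for k
  proof (cases k)
    case (Pair n l)
    have "cpoly (\<lambda>P. if (n, l) \<in> S then 0 else P $ (n, l))"
      by (cases "(n, l) \<in> S") (simp_all add: cpoly.const cpoly.coord)
    then show ?thesis unfolding Pair F Y_def
      by (intro cpoly.add cpoly_sum cpoly.mult cX) (simp_all add: cpoly.add cpoly.const cR)
  qed
  \<comment> \<open>The free entries of \<open>Y P0\<close> are entries of \<open>A\<close> at
    positions outside its support, hence zero; so \<open>Y P0\<close> is the identity.\<close>
  define P0 :: "complex ^ ('n \<times> 'n)" where "P0 = (\<chi> k. A $ fst k $ snd k)"
  have X0: "left_factor A P0 = A" by (simp add: left_factor_def P0_def vec_eq_iff)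
  have Y0: "Y P0 = mat 1"
    by (auto simp: Y_def right_part_def P0_def vec_eq_iff N_def nz_entries_def intro!: sum.neutral)
  define L where "L k v = (A ** right_part N mu v) $ fst k $ snd k + left_factor A v $ fst k $ snd k +
      (if k \<in> S then 0 else v $ k)" for k v
  have dX: "((\<lambda>P. left_factor A P $ n $ m) has_derivative (\<lambda>v. left_factor A v $ n $ m)) (at P0)" for n m
    by (cases "A $ n $ m = 0")
      (simp_all add: left_factor_def bounded_linear_imp_has_derivative bounded_linear_vec_nth)
  have dR: "((\<lambda>P. right_part N mu P $ m $ l) has_derivative (\<lambda>v. right_part N mu v $ m $ l)) (at P0)" for m l
    unfolding right_part_def vec_lambda_beta
  proof (rule has_derivative_sum)
    show "((\<lambda>P. if (k, l) \<in> N \<and> mu (k, l) = m then P $ (k, l) else 0) has_derivative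
       (\<lambda>v. if (k, l) \<in> N \<and> mu (k, l) = m then v $ (k, l) else 0)) (at P0)" for k
      by (cases "(k, l) \<in> N"; cases "mu (k, l) = m")
        (simp_all add: bounded_linear_imp_has_derivative bounded_linear_vec_nth)
  qed
  have dF: "((\<lambda>P. F P $ k) has_derivative L k) (at P0)" for k
  proof (cases k)
    case (Pair n l)
    have 1: "((\<lambda>P. Y P $ m $ l) has_derivative (\<lambda>v. right_part N mu v $ m $ l)) (at P0)" for m
      using has_derivative_add[OF has_derivative_const dR] by (simp add: Y_def)
    have "((\<lambda>P. \<Sum>m\<in>UNIV. left_factor A P $ n $ m * Y P $ m $ l) has_derivative
      (\<lambda>v. \<Sum>m\<in>UNIV. left_factor A P0 $ n $ m * right_part N mu v $ m $ l +
         left_factor A v $ n $ m * Y P0 $ m $ l)) (at P0)"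
      by (intro has_derivative_sum has_derivative_mult dX 1)
    moreover have "(\<Sum>m\<in>UNIV. left_factor A v $ n $ m * mat 1 $ m $ l) = left_factor A v $ n $ l" for v
      by (simp add: mat_def if_distrib[of "\<lambda>a. _ * a"] cong: if_cong)
    moreover have "((\<lambda>P. if (n, l) \<in> S then 0 else P $ (n, l)) has_derivative
      (\<lambda>v. if (n, l) \<in> S then 0 else v $ (n, l))) (at P0)"
      by (cases "(n, l) \<in> S") (simp_all add: bounded_linear_imp_has_derivative bounded_linear_vec_nth)
    ultimately show ?thesis unfolding Pair F L_def X0 Y0
      by (auto intro!: has_derivative_add simp: sum.distrib matrix_matrix_mult_def)
  qed
  have inj: "v = 0" if L0: "\<And>k. L k v = 0" for v
  proof -
    have AR: "(A ** right_part N mu v) $ n $ l =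
      (\<Sum>k\<in>UNIV. if (k, l) \<in> N then A $ n $ mu (k, l) * v $ (k, l) else 0)" for n l
    proof -
      have "(A ** right_part N mu v) $ n $ l = (\<Sum>m\<in>UNIV. \<Sum>k\<in>UNIV.
          if m = mu (k, l) then (if (k, l) \<in> N then A $ n $ m * v $ (k, l) else 0) else 0)"
        unfolding matrix_matrix_mult_def right_part_def vec_lambda_beta sum_distrib_left
        by (intro sum.cong refl) auto
      then show ?thesis by (subst (asm) sum.swap) simp
    qed
    \<comment> \<open>Any nonzero contribution of \<open>A\<close> here would put
      \<open>(n, l)\<close> into \<open>S\<close>; for \<open>A $ n $ l\<close> itself the
      intermediate index is \<open>l\<close>, by the nonzero diagonal of \<open>B\<close>. Only the
      retained coordinate of \<open>v\<close> is left.\<close>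
    have outside: "v $ (n, l) = 0" if "(n, l) \<notin> S" for n l
    proof -
      have A0: "A $ n $ mu (k, l) = 0" if "(k, l) \<in> N" for k
        using nz_entries_mult[OF comp _ mu(2)[OF that]] \<open>(n, l) \<notin> S\<close> by (auto simp: S_def)
      have "A $ n $ l = 0"
        using nz_entries_mult[OF comp, of n l l] \<open>(n, l) \<notin> S\<close> comp
        by (auto simp: S_def compatible_def)
      moreover have "(A ** right_part N mu v) $ n $ l = 0"
        unfolding AR by (intro sum.neutral) (simp add: A0)
      ultimately show ?thesis using L0[of "(n, l)"] \<open>(n, l) \<notin> S\<close> by (simp add: L_def left_factor_def)
    qed
    \<comment> \<open>At a new entry the term from \<open>X\<close> is absent, and
      \<open>uniq\<close> leaves only the summand \<open>k = n\<close>, whose coefficient is nonzero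
      by the choice of \<open>mu\<close>.\<close>
    have new: "v $ (n, l) = 0" if "(n, l) \<in> N" for n l
    proof -
      have "(A ** right_part N mu v) $ n $ l =
        (\<Sum>k\<in>UNIV. if k = n then A $ n $ mu (n, l) * v $ (n, l) else 0)"
        unfolding AR using uniq[OF that] that by (intro sum.cong refl) auto
      then have "A $ n $ mu (n, l) * v $ (n, l) = 0"
        using L0[of "(n, l)"] that by (simp add: L_def left_factor_def N_def nz_entries_def)
      then show ?thesis using mu(1)[OF that] by simp
    qed
    have "v $ (n, l) = 0" if "(n, l) \<in> S - N" for n l
    proof -
      have "(A ** right_part N mu v) $ n $ l = 0"
        unfolding AR by (intro sum.neutral) (simp add: new)
      then show ?thesis using L0[of "(n, l)"] that
        by (auto simp: L_def left_factor_def N_def nz_entries_def)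
    qed
    then have "v $ (n, l) = 0" for n l using outside new by blast
    then show "v = 0" by (auto simp: vec_eq_iff)
  qed
  obtain g y1 where g: "cpoly g" "g y1 \<noteq> 0" "{y. g y \<noteq> 0} \<subseteq> range F"
    using polynomial_map_range_contains_generic[OF cF dF inj] by blast
  define W where "W = (\<chi> k. if k \<in> S then 0 else y1 $ k)"
  have "\<exists>C\<in>spr (A ** B). g ((\<chi> k. C $ fst k $ snd k) + W) \<noteq> 0"
  proof
    let ?C = "\<chi> n l. if (n, l) \<in> S then y1 $ (n, l) else 0"
    have "(\<chi> k. ?C $ fst k $ snd k) + W = y1" by (auto simp: W_def vec_eq_iff)
    then show "g ((\<chi> k. ?C $ fst k $ snd k) + W) \<noteq> 0" using g(2) by simp
    show "?C \<in> spr (A ** B)" by (auto simp: spr_def S_def nz_entries_def)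
  qed
  moreover have "C \<in> prod_range A B"
    if C: "C \<in> spr (A ** B)" "g ((\<chi> k. C $ fst k $ snd k) + W) \<noteq> 0" for C
  proof -
    obtain P where P: "F P = (\<chi> k. C $ fst k $ snd k) + W"
      using g(3) C(2) by (metis (mono_tags) imageE mem_Collect_eq subsetD)
    \<comment> \<open>Only the coordinates in \<open>S\<close> are read off from \<open>F P\<close>;
      elsewhere both matrices vanish by their support.\<close>
    have "(left_factor A P ** Y P) $ n $ l = C $ n $ l" for n l
    proof (cases "(n, l) \<in> S")
      case True
      have "F P $ (n, l) = C $ n $ l" unfolding P using True by (simp add: W_def)
      then show ?thesis using True by (simp add: F_def)
    next
      case False
      then have "(A ** B) $ n $ l = 0" by (simp add: S_def nz_entries_def)
      then show ?thesis using C(1) mult_in_spr[OF comp X_spr Y_spr, of P P] by (simp add: spr_def)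
    qed
    then have "C = left_factor A P ** Y P" by (simp add: vec_eq_iff)
    then show ?thesis using X_spr Y_spr unfolding prod_range_def by auto
  qed
  ultimately show ?thesis using g(1) by blast
qed

section \<open>Density and measure zero for the range of the product map\<close>

theorem mainTheorem2:
  fixes A B :: "complex ^ 'n ^ 'n"
  assumes "compatible A B"
    and "simple_extension A B"
  shows "(\<exists>U \<subseteq> prod_range A B.
      openin (top_of_set (spr (A ** B))) U \<and> spr (A ** B) \<subseteq> closure U) \<and>
    closure (spr (A ** B) - prod_range A B) \<in> null_sets (subspace_lebesgue (spr (A ** B))) \<and>
    (\<exists>Z \<subseteq> spr (A ** B). closure Z \<in> null_sets (subspace_lebesgue (spr (A ** B))) \<and>
      (\<forall>C \<in> spr (A ** B) - Z. \<exists>X \<in> spr A. \<exists>Y \<in> spr B. X ** Y = C))"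
proof -
  let ?S = "spr (A ** B)"
  define flat where "flat C = (\<chi> k. C $ fst k $ snd k)" for C :: "complex ^ 'n ^ 'n"
  obtain g W C1 where g: "cpoly g" "C1 \<in> ?S" "g (flat C1 + W) \<noteq> 0"
    "\<And>C. C \<in> ?S \<Longrightarrow> g (flat C + W) \<noteq> 0 \<Longrightarrow> C \<in> prod_range A B"
    using generic_factorization[OF assms] unfolding flat_def by blast
  define f where "f C = g (flat C + W)" for C
  have "continuous_on UNIV (\<lambda>C. flat C + W)"
    unfolding flat_def by (intro continuous_intros)
  then have cont: "continuous_on UNIV f"
    unfolding f_def by (rule continuous_on_compose2[OF cpoly_continuous[OF g(1), of UNIV]]) simp
  have line: "\<exists>q. \<forall>t::real. f (C + t *\<^sub>R D) = poly q (of_real t)" for C D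
  proof -
    have "flat (C + t *\<^sub>R D) + W = (flat C + W) + t *\<^sub>R flat D" for t
      by (simp add: flat_def vec_eq_iff)
    then show ?thesis unfolding f_def using cpoly_real_line[OF g(1), of "flat C + W" "flat D"] by metis
  qed
  let ?U = "{C \<in> ?S. f C \<noteq> 0}"
  let ?Z = "{C \<in> ?S. f C = 0}"
  have "?U = ?S \<inter> f -` (- {0})" by auto
  then have U: "openin (top_of_set ?S) ?U"
    using continuous_openin_preimage_gen[OF continuous_on_subset[OF cont subset_UNIV], of "- {0}" ?S] by (simp add: open_Compl)
  have dense: "?S \<subseteq> closure ?U"
  proof
    fix C assume C: "C \<in> ?S"
    show "C \<in> closure ?U"
    proof (unfold closure_approachable, intro allI impI)
      fix e :: real assume e: "e > 0"
      \<comment> \<open>The line towards \<open>C1\<close>, where \<open>f\<close> is nonzero, stays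
        in the subspace and meets the zero set of \<open>f\<close> in finitely many points.\<close>
      obtain q where "\<And>t::real. f (C + t *\<^sub>R (C1 - C)) = poly q (of_real t)" using line by blast
      from nonzero_near_on_line[OF this _ e] g(3) obtain t where
        t: "dist (C + t *\<^sub>R (C1 - C)) C < e" "f (C + t *\<^sub>R (C1 - C)) \<noteq> 0" by (auto simp: f_def)
      have "C + t *\<^sub>R (C1 - C) \<in> ?S"
        using C g(2) by (intro subspace_add subspace_scale subspace_diff subspace_spr)
      then show "\<exists>y\<in>?U. dist y C < e" using t by blast
    qed
  qed
  have closed_Z: "closed ?Z"
  proof -
    have "?Z = ?S \<inter> f -` {0}" by auto
    then show ?thesis
      using closed_spr closed_vimage[OF closed_singleton, of f 0] cont closed_Int by metis
  qed
  \<comment> \<open>The zero set of \<open>f\<close> is closed and therefore absorbs the closure of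
    the exceptional set.\<close>
  have "?S - prod_range A B \<subseteq> ?Z" using g(4) by (auto simp: f_def)
  then have "closure (?S - prod_range A B) \<subseteq> ?Z" using closed_Z by (rule closure_minimal)
  moreover have "?Z \<in> null_sets (subspace_lebesgue ?S)"
    using null_zero_set_subspace[OF subspace_spr cont line g(2)] g(3) by (simp add: f_def)
  ultimately have null: "closure (?S - prod_range A B) \<in> null_sets (subspace_lebesgue ?S)"
    unfolding subspace_lebesgue_def by (rule null_sets_completion_subset)
  have "?U \<subseteq> prod_range A B" using g(4) by (auto simp: f_def)
  moreover have "\<exists>X\<in>spr A. \<exists>Y\<in>spr B. X ** Y = C" if "C \<in> ?S - (?S - prod_range A B)" for C
    using that by (auto simp: prod_range_def)
  ultimately show ?thesis using U dense null by (meson Diff_subset)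
qed

end
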